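(* Let $d$ and $\rho$ be two locally Lipschitz equivalent metrics on a set $M$ and suppose that $M$ is locally compact (with respect to $d$, equivalently $\rho$). Let $\varphi:G\times M\to M$ be a continuous left action of a topological group $G$ on $M$ and let $X\subset M$ be a non-empty compact subset. Then: (1) $d_X$ and $\rho_X$ are locally Lipschitz equivalent on $G/H_X$; (2) $\hat d_X$ and $\hat\rho_X$ are locally Lipschitz equivalent on $G/H_X$.
   Context: Two metrics $d,\rho$ (possibly taking the value $+\infty$) on a set $N$ are locally Lipschitz equivalent if they induce the same topology on $N$ and for every $p\in N$ there exist constants $c_p,C_p>0$ and a neighborhood $V_p$ of $p$ such that $c_p\,d(x,y)\le\rho(x,y)\le C_p\,d(x,y)$ for all $x,y\in V_p$. $H_X=\{g\in G:gX=X\}$ is the isotropy subgroup of $X$. The induced Hausdorff metric on $G/H_X$ is $d_X(g_1H_X,g_2H_X)=d_H(g_1X,g_2X)$, where $d_H(A,B)=\max\{\sup_{a\in A}d(a,B),\sup_{b\in B}d(b,A)\}$; $\rho_X$ is defined in the same way from $\rho$. For a metric $\sigma$ on a set $N$, the length of a $\sigma$-continuous path is $\ell_\sigma(\gamma)=\sup\sum_i\sigma(\gamma(t_i),\gamma(t_{i-1}))$ over partitions of its domain, and the induced intrinsic (possibly infinite-valued) metric is $\hat\sigma(x,y)=\inf_\gamma\ell_\sigma(\gamma)$ over $\sigma$-continuous paths $\gamma$ from $x$ to $y$ ($\inf\emptyset=+\infty$). $\hat d_X$ and $\hat\rho_X$ are the intrinsic metrics induced by $d_X$ and $\rho_X$.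 *)

theory Defs
  imports "HOL-Analysis.Analysis" "HOL-Algebra.Group_Action" "HOL-Algebra.Left_Coset"
begin

text \<open>The library's \<^locale>\<open>Metric_space\<close> only covers real-valued metrics. The metrics here may take
  the value \<open>+\<infinity>\<close>, so they are functions into \<^typ>\<open>ennreal\<close> on an explicit carrier set; the
  lemmas below show that real-valued metrics are a special case, with the same topology.\<close>

definition ext_metric :: "'a set \<Rightarrow> ('a \<Rightarrow> 'a \<Rightarrow> ennreal) \<Rightarrow> bool" where
  "ext_metric N d \<longleftrightarrow>
     (\<forall>x\<in>N. \<forall>y\<in>N. d x y = 0 \<longleftrightarrow> x = y) \<and>
     (\<forall>x\<in>N. \<forall>y\<in>N. d x y = d y x) \<and>
     (\<forall>x\<in>N. \<forall>y\<in>N. \<forall>z\<in>N. d x z \<le> d x y + d y z)"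

definition ext_mtopology :: "'a set \<Rightarrow> ('a \<Rightarrow> 'a \<Rightarrow> ennreal) \<Rightarrow> 'a topology" where
  "ext_mtopology N d =
     topology (\<lambda>U. U \<subseteq> N \<and> (\<forall>x\<in>U. \<exists>r>0. {y\<in>N. d x y < r} \<subseteq> U))"

lemma openin_ext_mtopology:
  "openin (ext_mtopology N d) U \<longleftrightarrow> U \<subseteq> N \<and> (\<forall>x\<in>U. \<exists>r>0. {y\<in>N. d x y < r} \<subseteq> U)"
proof -
  have "istopology (\<lambda>U. U \<subseteq> N \<and> (\<forall>x\<in>U. \<exists>r>0. {y\<in>N. d x y < r} \<subseteq> U))" (is "istopology ?P")
    unfolding istopology_def
  proof (intro conjI allI impI)
    fix S T assume S: "?P S" and T: "?P T"
    show "S \<inter> T \<subseteq> N" using S by blast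
    show "\<forall>x\<in>S \<inter> T. \<exists>r>0. {y \<in> N. d x y < r} \<subseteq> S \<inter> T"
    proof
      fix x assume x: "x \<in> S \<inter> T"
      from x S obtain r where "r > 0" "{y\<in>N. d x y < r} \<subseteq> S" by blast
      moreover from x T obtain s where "s > 0" "{y\<in>N. d x y < s} \<subseteq> T" by blast
      ultimately show "\<exists>r>0. {y\<in>N. d x y < r} \<subseteq> S \<inter> T"
        by (intro exI[of _ "min r s"]) auto
    qed
  next
    fix \<K> assume K: "\<forall>K\<in>\<K>. ?P K"
    show "\<Union>\<K> \<subseteq> N" using K by blast
    show "\<forall>x\<in>\<Union>\<K>. \<exists>r>0. {y\<in>N. d x y < r} \<subseteq> \<Union>\<K>"
      using K by (meson UnionE Union_upper order_trans)
  qed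
  then show ?thesis
    by (simp add: ext_mtopology_def)
qed

lemma topspace_ext_mtopology [simp]: "topspace (ext_mtopology N d) = N"
proof -
  have "openin (ext_mtopology N d) N"
    unfolding openin_ext_mtopology by (metis (no_types, lifting) mem_Collect_eq subsetI zero_less_one)
  then show ?thesis
    by (meson openin_ext_mtopology openin_subset openin_topspace subset_antisym)
qed

lemma (in Metric_space) ext_metric_ennreal: "ext_metric M (\<lambda>x y. ennreal (d x y))"
  unfolding ext_metric_def
  by (auto simp: commute triangle simp flip: ennreal_plus intro!: ennreal_leI)

lemma (in Metric_space) ext_mtopology_ennreal:
  "ext_mtopology M (\<lambda>x y. ennreal (d x y)) = mtopology"
proof (rule topology_eq[THEN iffD2], rule allI)
  fix U
  have *: "(\<exists>r>0. {y\<in>M. ennreal (d x y) < r} \<subseteq> U) \<longleftrightarrow> (\<exists>r>0. mball x r \<subseteq> U)"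
    if "x \<in> M" for x
  proof
    assume "\<exists>r>0. {y\<in>M. ennreal (d x y) < r} \<subseteq> U"
    then obtain r where r: "r > 0" "{y\<in>M. ennreal (d x y) < r} \<subseteq> U" by blast
    obtain s where s: "s > 0" "ennreal s \<le> r"
    proof (cases r)
      case (real t)
      then show ?thesis using r(1) that[of t] by (auto simp: ennreal_zero_less_top)
    next
      case top
      then show ?thesis using that[of 1] by simp
    qed
    have "mball x s \<subseteq> U"
    proof
      fix y assume y: "y \<in> mball x s"
      then have "ennreal (d x y) < ennreal s" using s(1) by (simp add: ennreal_lessI)
      with y s(2) r(2) show "y \<in> U" by (auto dest: order_less_le_trans)
    qed
    with s(1) show "\<exists>r>0. mball x r \<subseteq> U" by blast
  next
    assume "\<exists>r>0. mball x r \<subseteq> U"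
    then obtain r where r: "r > 0" "mball x r \<subseteq> U" by blast
    have "{y\<in>M. ennreal (d x y) < ennreal r} \<subseteq> U"
      using r that by (auto simp: ennreal_less_iff)
    with r(1) show "\<exists>r>0. {y\<in>M. ennreal (d x y) < r} \<subseteq> U"
      by (intro exI[of _ "ennreal r"]) simp
  qed
  show "openin (ext_mtopology M (\<lambda>x y. ennreal (d x y))) U = openin mtopology U"
    unfolding openin_ext_mtopology openin_mtopology using * by (meson subsetD)
qed

definition locally_Lipschitz_equivalent ::
  "'a set \<Rightarrow> ('a \<Rightarrow> 'a \<Rightarrow> ennreal) \<Rightarrow> ('a \<Rightarrow> 'a \<Rightarrow> ennreal) \<Rightarrow> bool" where
  "locally_Lipschitz_equivalent N d \<rho> \<longleftrightarrow>
     ext_metric N d \<and> ext_metric N \<rho> \<and>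
     ext_mtopology N d = ext_mtopology N \<rho> \<and>
     (\<forall>p\<in>N. \<exists>c C :: real. \<exists>V. c > 0 \<and> C > 0 \<and> openin (ext_mtopology N d) V \<and> p \<in> V \<and>
        (\<forall>x\<in>V. \<forall>y\<in>V. ennreal c * d x y \<le> \<rho> x y \<and> \<rho> x y \<le> ennreal C * d x y))"

definition hausdorff_edist :: "('a \<Rightarrow> 'a \<Rightarrow> ennreal) \<Rightarrow> 'a set \<Rightarrow> 'a set \<Rightarrow> ennreal" where
  "hausdorff_edist d A B =
     max (SUP a\<in>A. INF b\<in>B. d a b) (SUP b\<in>B. INF a\<in>A. d b a)"

text \<open>Partitions may repeat points, which adds only zero terms. An arbitrary compact parameter
  interval is reparametrised affinely to the unit interval used by \<^const>\<open>pathin\<close>.\<close>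

definition ext_path_length :: "('a \<Rightarrow> 'a \<Rightarrow> ennreal) \<Rightarrow> (real \<Rightarrow> 'a) \<Rightarrow> ennreal" where
  "ext_path_length \<sigma> \<gamma> =
     Sup {(\<Sum>i=1..n. \<sigma> (\<gamma> (t i)) (\<gamma> (t (i - 1)))) | (n::nat) t.
            t 0 = 0 \<and> t n = 1 \<and> (\<forall>i\<in>{1..n}. t (i - 1) \<le> t i)}"

definition intrinsic_edist ::
  "'a set \<Rightarrow> ('a \<Rightarrow> 'a \<Rightarrow> ennreal) \<Rightarrow> 'a \<Rightarrow> 'a \<Rightarrow> ennreal" where
  "intrinsic_edist N \<sigma> x y =
     Inf {ext_path_length \<sigma> \<gamma> | \<gamma>. pathin (ext_mtopology N \<sigma>) \<gamma> \<and> \<gamma> 0 = x \<and> \<gamma> 1 = y}"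

definition topological_group :: "('g, 'm) monoid_scheme \<Rightarrow> 'g topology \<Rightarrow> bool" where
  "topological_group G T \<longleftrightarrow>
     group G \<and> topspace T = carrier G \<and>
     continuous_map (prod_topology T T) T (\<lambda>(g, h). g \<otimes>\<^bsub>G\<^esub> h) \<and>
     continuous_map T T (\<lambda>g. inv\<^bsub>G\<^esub> g)"

definition isotropy :: "('g, 'm) monoid_scheme \<Rightarrow> ('g \<Rightarrow> 'a \<Rightarrow> 'a) \<Rightarrow> 'a set \<Rightarrow> 'g set" where
  "isotropy G \<phi> X = stabilizer G (\<lambda>g Y. \<phi> g ` Y) X"

text \<open>The translate \<open>gX\<close> depends only on the coset \<open>gH\<^sub>X\<close>, so it is read off from the coset as the
  unique translate by one of its elements (see \<open>coset_hausdorff_l_coset\<close>).\<close>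

definition coset_translate :: "('g \<Rightarrow> 'a \<Rightarrow> 'a) \<Rightarrow> 'a set \<Rightarrow> 'g set \<Rightarrow> 'a set" where
  "coset_translate \<phi> X C = the_elem ((\<lambda>g. \<phi> g ` X) ` C)"

definition coset_hausdorff ::
  "('g \<Rightarrow> 'a \<Rightarrow> 'a) \<Rightarrow> 'a set \<Rightarrow> ('a \<Rightarrow> 'a \<Rightarrow> ennreal) \<Rightarrow> 'g set \<Rightarrow> 'g set \<Rightarrow> ennreal" where
  "coset_hausdorff \<phi> X d C\<^sub>1 C\<^sub>2 =
     hausdorff_edist d (coset_translate \<phi> X C\<^sub>1) (coset_translate \<phi> X C\<^sub>2)"

lemma coset_translate_l_coset:
  assumes "group_action G M \<phi>" "X \<subseteq> M" "g \<in> carrier G"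
  shows "coset_translate \<phi> X (g <#\<^bsub>G\<^esub> isotropy G \<phi> X) = \<phi> g ` X"
proof -
  interpret group_action G M \<phi> by fact
  interpret group G using group_hom by (simp add: group_hom_def)
  have "\<phi> (g \<otimes>\<^bsub>G\<^esub> h) ` X = \<phi> g ` X" if "h \<in> isotropy G \<phi> X" for h
  proof -
    from that have h: "h \<in> carrier G" "\<phi> h ` X = X"
      by (auto simp: isotropy_def stabilizer_def)
    have "\<phi> (g \<otimes>\<^bsub>G\<^esub> h) ` X = \<phi> g ` (\<phi> h ` X)"
      using assms(2,3) h(1) composition_rule unfolding image_image
      by (intro image_cong) auto
    with h(2) show ?thesis by simp
  qed
  moreover have "\<one>\<^bsub>G\<^esub> \<in> isotropy G \<phi> X"
  proof -
    have "\<phi> \<one>\<^bsub>G\<^esub> ` X = (\<lambda>x. x) ` X"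
      using assms(2) by (intro image_cong) (auto simp flip: id_eq_one)
    then show ?thesis by (simp add: isotropy_def stabilizer_def)
  qed
  ultimately have "(\<lambda>k. \<phi> k ` X) ` (g <#\<^bsub>G\<^esub> isotropy G \<phi> X) = {\<phi> g ` X}"
    unfolding l_coset_def by (force simp: image_UN)
  then show ?thesis by (simp add: coset_translate_def)
qed

lemma coset_hausdorff_l_coset:
  assumes "group_action G M \<phi>" "X \<subseteq> M" "g\<^sub>1 \<in> carrier G" "g\<^sub>2 \<in> carrier G"
  shows "coset_hausdorff \<phi> X d (g\<^sub>1 <#\<^bsub>G\<^esub> isotropy G \<phi> X) (g\<^sub>2 <#\<^bsub>G\<^esub> isotropy G \<phi> X) =
    hausdorff_edist d (\<phi> g\<^sub>1 ` X) (\<phi> g\<^sub>2 ` X)"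
  using assms by (simp add: coset_hausdorff_def coset_translate_l_coset)

end

theory Submission
  imports Defs
begin

text \<open>Local Lipschitz equivalence splits into two one-sided conditions, each saying that one metric is
  bounded by a multiple of the other on small balls of the latter. Such a one-sided bound holds
  uniformly near a compact set \<open>A\<close> for points at small distance, and this suffices for the Hausdorff
  distance of sets close to \<open>A\<close>. It also passes to intrinsic metrics, since a path that is short for one
  metric stays in a small ball; the paths are the same for both metrics because the topologies
  agree.\<close>

text \<open>Both distances involve infima, over points of a set or over paths, and no minimiser is
  ever chosen, while domination controls only competitors that stay near \<open>p\<close>. The
  common core is \<open>INF_le_mult_INF\<close>: once an infimum lies below a threshold, competitors
  at or above the threshold can be ignored. In both cases the radius \<open>r\<close> is divided by
  4: two objects within \<open>r / 4\<close> of the base object are within \<open>r / 2\<close> of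
  each other, and a competitor below \<open>r / 2\<close> then stays within \<open>r\<close> of a
  centre at which domination holds. The neighbourhood in \<open>locally_dominated\<close> is a ball
  of \<open>d\<close> itself, so balls of a larger metric, such as the intrinsic one, lie inside it,
  and equality of the topologies follows from the two dominations. The constant is a real number,
  hence finite, whereas radii and distances may be infinite.\<close>

definition locally_dominated ::
  "'a set \<Rightarrow> ('a \<Rightarrow> 'a \<Rightarrow> ennreal) \<Rightarrow> ('a \<Rightarrow> 'a \<Rightarrow> ennreal) \<Rightarrow> bool" where
  "locally_dominated N d \<rho> \<longleftrightarrow>
     (\<forall>p\<in>N. \<exists>r>0. \<exists>C>0. \<forall>x\<in>N. \<forall>y\<in>N. d p x < r \<longrightarrow> d p y < r \<longrightarrow> \<rho> x y \<le> ennreal C * d x y)"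

lemma ext_metricD:
  assumes "ext_metric N d"
  shows ext_metric_zero: "\<lbrakk>x \<in> N; y \<in> N\<rbrakk> \<Longrightarrow> d x y = 0 \<longleftrightarrow> x = y"
    and ext_metric_commute: "\<lbrakk>x \<in> N; y \<in> N\<rbrakk> \<Longrightarrow> d x y = d y x"
    and ext_metric_triangle: "\<lbrakk>x \<in> N; y \<in> N; z \<in> N\<rbrakk> \<Longrightarrow> d x z \<le> d x y + d y z"
  using assms unfolding ext_metric_def by blast+

section \<open>Arithmetic and infima of extended nonnegative reals\<close>

lemma add_less_half_ennreal:
  fixes a b r :: ennreal
  assumes "a < r / 2" "b < r / 2"
  shows "a + b < r"
proof -
  have "a + b < r / 2 + r / 2"
    using assms by (intro add_strict_mono)
  also have "r / 2 + r / 2 = r"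
    by (subst add_divide_distrib_ennreal[symmetric], subst mult_2_right[symmetric])
       (simp add: ennreal_mult_divide_eq)
  finally show ?thesis .
qed

lemma half_less_ennreal: "a < r / 2 \<Longrightarrow> a < r" for a r :: ennreal
  using add_less_half_ennreal[of a r 0] le_less_trans[OF zero_le, of a "r / 2"] by simp

lemma half_pos_ennreal: "0 < r \<Longrightarrow> 0 < r / 2" for r :: ennreal
  by (simp add: ennreal_zero_less_divide)

lemma mult_divide_cancel_ennreal: "C > 0 \<Longrightarrow> ennreal C * (x / ennreal C) = x"
  by (subst ennreal_times_divide, subst mult.commute) (simp add: ennreal_mult_divide_eq)

text \<open>A finite \<open>c\<close> can be moved to the left, which leaves a lower bound of all
  \<open>f i\<close>; an infinite \<open>c\<close> makes the right side infinite. An empty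
  \<open>I\<close> is covered, its infimum being infinite: this is the case of points joined by no
  path.\<close>

lemma le_add_INF_ennreal:
  fixes f :: "'b \<Rightarrow> ennreal"
  assumes "\<And>i. i \<in> I \<Longrightarrow> a \<le> c + f i"
  shows "a \<le> c + (INF i\<in>I. f i)"
proof (cases "c = \<infinity>")
  case False
  then have "a - c \<le> (INF i\<in>I. f i)"
    using assms by (intro INF_greatest) (simp add: ennreal_minus_le_iff)
  with False show ?thesis by (simp add: ennreal_minus_le_iff)
qed simp

text \<open>Some \<open>z\<close> has \<open>f z < r\<close>, and its bound \<open>C * f z\<close>
  is below \<open>C * f y\<close> for every \<open>y\<close> with \<open>f y \<ge> r\<close>. Hence
  the comparison, assumed only below \<open>r\<close>, reaches all competitors.\<close>

lemma INF_le_mult_INF: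
  fixes f g :: "'b \<Rightarrow> ennreal"
  assumes "C > 0" "(INF y\<in>B. f y) < r"
    and le: "\<And>y. \<lbrakk>y \<in> B; f y < r\<rbrakk> \<Longrightarrow> g y \<le> ennreal C * f y"
  shows "(INF y\<in>B. g y) \<le> ennreal C * (INF y\<in>B. f y)"
proof -
  obtain z where z: "z \<in> B" "f z < r"
    using assms(2) by (auto simp: INF_less_iff)
  have "(INF y\<in>B. g y) \<le> ennreal C * f y" if "y \<in> B" for y
  proof (cases "f y < r")
    case True
    then show ?thesis using le[OF that] that by (meson INF_lower order_trans)
  next
    case False
    have "(INF y\<in>B. g y) \<le> ennreal C * f z"
      using le[OF z] z(1) by (meson INF_lower order_trans)
    also have "\<dots> \<le> ennreal C * f y"
      using False z(2) by (intro mult_left_mono) auto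
    finally show ?thesis .
  qed
  \<comment> \<open>Dividing by \<open>C\<close> yields a lower bound of all \<open>f y\<close>,
    which passes to their infimum.\<close>
  then have "(INF y\<in>B. g y) / ennreal C \<le> f y" if "y \<in> B" for y
    using that assms(1) by (intro divide_le_posI_ennreal) auto
  then have "(INF y\<in>B. g y) / ennreal C \<le> (INF y\<in>B. f y)"
    by (rule INF_greatest)
  then have "ennreal C * ((INF y\<in>B. g y) / ennreal C) \<le> ennreal C * (INF y\<in>B. f y)"
    by (rule mult_left_mono) simp
  then show ?thesis
    by (simp add: mult_divide_cancel_ennreal[OF assms(1)])
qed

lemma ext_metric_halves:
  assumes "ext_metric N d" "x \<in> N" "y \<in> N" "z \<in> N" "d x y < r / 2" "d y z < r / 2"
  shows "d x z < r"
  using ext_metric_triangle[OF assms(1-4)] add_less_half_ennreal[OF assms(5,6)]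
  by (rule le_less_trans)

section \<open>Balls, topologies and one-sided domination\<close>

lemma openin_ext_ball:
  assumes "ext_metric N d" "p \<in> N"
  shows "openin (ext_mtopology N d) {x\<in>N. d p x < r}"
  unfolding openin_ext_mtopology
proof (intro conjI ballI)
  fix x assume x: "x \<in> {x\<in>N. d p x < r}"
  show "\<exists>s>0. {y\<in>N. d x y < s} \<subseteq> {x\<in>N. d p x < r}"
  proof (intro exI conjI)
    show "r - d p x > 0" using x by (simp add: diff_gr0_ennreal)
    show "{y\<in>N. d x y < r - d p x} \<subseteq> {x\<in>N. d p x < r}"
    proof
      fix y assume y: "y \<in> {y\<in>N. d x y < r - d p x}"
      have "d p y \<le> d p x + d x y"
        using ext_metric_triangle[OF assms(1)] assms(2) x y by simp
      also have "\<dots> < d p x + (r - d p x)"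
        using x y by (auto simp: ennreal_add_left_cancel_less)
      also have "\<dots> = r"
        using x by (intro add_diff_inverse_ennreal) auto
      finally show "y \<in> {x\<in>N. d p x < r}" using y by simp
    qed
  qed
qed auto

text \<open>With the centre as one of the two points, domination bounds \<open>\<rho> x y\<close> by
  \<open>C * d x y\<close> on a \<open>d\<close>-ball around \<open>x\<close>, so the identity is
  continuous from the topology of \<open>d\<close> to that of \<open>\<rho>\<close>. The radius is
  capped by \<open>r\<close> for domination to apply and by \<open>s / C\<close> to land in the
  \<open>\<rho>\<close>-ball of radius \<open>s\<close>.\<close>

lemma locally_dominated_openin:
  assumes "ext_metric N d" "locally_dominated N d \<rho>" "openin (ext_mtopology N \<rho>) U"
  shows "openin (ext_mtopology N d) U"
  unfolding openin_ext_mtopology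
proof (intro conjI ballI)
  show "U \<subseteq> N" using assms(3) by (simp add: openin_ext_mtopology)
  fix x assume "x \<in> U"
  then obtain s where s: "s > 0" "{y\<in>N. \<rho> x y < s} \<subseteq> U" and xN: "x \<in> N"
    using assms(3) unfolding openin_ext_mtopology by blast
  obtain r C where r: "r > 0" "C > 0"
    and le: "\<And>y z. \<lbrakk>y \<in> N; z \<in> N; d x y < r; d x z < r\<rbrakk> \<Longrightarrow> \<rho> y z \<le> ennreal C * d y z"
    using assms(2) xN unfolding locally_dominated_def by meson
  have x0: "d x x = 0" using ext_metric_zero[OF assms(1)] xN by simp
  show "\<exists>r>0. {y\<in>N. d x y < r} \<subseteq> U"
  proof (intro exI conjI)
    show "min r (s / ennreal C) > 0"
      using r s(1) by (simp add: ennreal_zero_less_divide)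
    show "{y\<in>N. d x y < min r (s / ennreal C)} \<subseteq> U"
    proof
      fix y assume y: "y \<in> {y\<in>N. d x y < min r (s / ennreal C)}"
      have "\<rho> x y \<le> ennreal C * d x y"
        using le[of x y] xN x0 y r(1) by simp
      also have "\<dots> < ennreal C * (s / ennreal C)"
        using y r(2) by (intro ennreal_mult_strict_left_mono) auto
      also have "\<dots> = s"
        by (rule mult_divide_cancel_ennreal[OF r(2)])
      finally show "y \<in> U" using s(2) y by auto
    qed
  qed
qed

text \<open>Exchanges a lower Lipschitz constant for the upper constant of the reverse
  domination.\<close>

lemma ennreal_inverse_mult_le_iff:
  assumes "c > 0"
  shows "ennreal (1 / c) * a \<le> b \<longleftrightarrow> a \<le> ennreal c * b"
proof -
  have "ennreal (1 / c) * a \<le> b \<longleftrightarrow> ennreal c * (ennreal (1 / c) * a) \<le> ennreal c * b"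
    using assms by (subst ennreal_mult_le_mult_iff) auto
  also have "ennreal c * (ennreal (1 / c) * a) = a"
    using assms by (simp flip: mult.assoc ennreal_mult)
  finally show ?thesis .
qed

text \<open>As the topologies agree, \<open>V\<close> contains a \<open>d\<close>-ball and a
  \<open>\<rho>\<close>-ball around \<open>p\<close>, one for each domination. Conversely, the
  intersection of a \<open>d\<close>-ball with a \<open>\<rho>\<close>-ball is open in the common
  topology and serves as \<open>V\<close>.\<close>

lemma locally_Lipschitz_equivalent_iff:
  "locally_Lipschitz_equivalent N d \<rho> \<longleftrightarrow>
     ext_metric N d \<and> ext_metric N \<rho> \<and> locally_dominated N d \<rho> \<and> locally_dominated N \<rho> d"
proof (intro iffI conjI)
  assume L: "locally_Lipschitz_equivalent N d \<rho>"
  show "ext_metric N d" "ext_metric N \<rho>"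
    using L by (auto simp: locally_Lipschitz_equivalent_def)
  have eq: "ext_mtopology N d = ext_mtopology N \<rho>"
    using L by (auto simp: locally_Lipschitz_equivalent_def)
  have V: "\<exists>c C V. c > 0 \<and> C > 0 \<and> openin (ext_mtopology N d) V \<and> p \<in> V \<and>
        (\<forall>x\<in>V. \<forall>y\<in>V. ennreal c * d x y \<le> \<rho> x y \<and> \<rho> x y \<le> ennreal C * d x y)" if "p \<in> N" for p
    using L that by (auto simp: locally_Lipschitz_equivalent_def)
  show "locally_dominated N d \<rho>"
    unfolding locally_dominated_def
  proof
    fix p assume "p \<in> N"
    from V[OF this] obtain c C V where V: "C > 0" "openin (ext_mtopology N d) V" "p \<in> V"
      "\<forall>x\<in>V. \<forall>y\<in>V. \<rho> x y \<le> ennreal C * d x y" by blast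
    then obtain r where "r > 0" "{y\<in>N. d p y < r} \<subseteq> V"
      unfolding openin_ext_mtopology by blast
    with V show "\<exists>r>0. \<exists>C>0. \<forall>x\<in>N. \<forall>y\<in>N. d p x < r \<longrightarrow> d p y < r \<longrightarrow> \<rho> x y \<le> ennreal C * d x y"
      by (intro exI[of _ r] exI[of _ C] conjI) auto
  qed
  show "locally_dominated N \<rho> d"
    unfolding locally_dominated_def
  proof
    fix p assume "p \<in> N"
    from V[OF this] obtain c C V where V: "c > 0" "openin (ext_mtopology N \<rho>) V" "p \<in> V"
      "\<forall>x\<in>V. \<forall>y\<in>V. ennreal c * d x y \<le> \<rho> x y" unfolding eq by blast
    then obtain r where "r > 0" "{y\<in>N. \<rho> p y < r} \<subseteq> V"
      unfolding openin_ext_mtopology by blast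
    with V show "\<exists>r>0. \<exists>C>0. \<forall>x\<in>N. \<forall>y\<in>N. \<rho> p x < r \<longrightarrow> \<rho> p y < r \<longrightarrow> d x y \<le> ennreal C * \<rho> x y"
      using ennreal_inverse_mult_le_iff[of "1 / c"]
      by (intro exI[of _ r] exI[of _ "1 / c"] conjI) auto
  qed
next
  assume "ext_metric N d \<and> ext_metric N \<rho> \<and> locally_dominated N d \<rho> \<and> locally_dominated N \<rho> d"
  then have m: "ext_metric N d" "ext_metric N \<rho>"
    and l: "locally_dominated N d \<rho>" "locally_dominated N \<rho> d" by auto
  have eq: "ext_mtopology N d = ext_mtopology N \<rho>"
    using locally_dominated_openin m l by (metis topology_eq)
  have "\<exists>c C V. c > 0 \<and> C > 0 \<and> openin (ext_mtopology N d) V \<and> p \<in> V \<and>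
        (\<forall>x\<in>V. \<forall>y\<in>V. ennreal c * d x y \<le> \<rho> x y \<and> \<rho> x y \<le> ennreal C * d x y)" if p: "p \<in> N" for p
  proof -
    obtain r C where r: "r > 0" "C > 0" 
      "\<forall>x\<in>N. \<forall>y\<in>N. d p x < r \<longrightarrow> d p y < r \<longrightarrow> \<rho> x y \<le> ennreal C * d x y"
      using l(1) p unfolding locally_dominated_def by meson
    obtain s c where s: "s > 0" "c > 0" 
      "\<forall>x\<in>N. \<forall>y\<in>N. \<rho> p x < s \<longrightarrow> \<rho> p y < s \<longrightarrow> d x y \<le> ennreal c * \<rho> x y"
      using l(2) p unfolding locally_dominated_def by meson
    let ?V = "{x\<in>N. d p x < r} \<inter> {x\<in>N. \<rho> p x < s}"
    have "openin (ext_mtopology N d) ?V"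
      using openin_ext_ball[OF m(1) p] openin_ext_ball[OF m(2) p] eq by auto
    moreover have "p \<in> ?V"
      using p r(1) s(1) ext_metric_zero[OF m(1) p p] ext_metric_zero[OF m(2) p p] by simp
    ultimately show ?thesis
      using r s ennreal_inverse_mult_le_iff[of c]
      by (intro exI[of _ "1 / c"] exI[of _ C] exI[of _ ?V]) auto
  qed
  then show "locally_Lipschitz_equivalent N d \<rho>"
    using m eq by (auto simp: locally_Lipschitz_equivalent_def)
qed

section \<open>Hausdorff distances\<close>

text \<open>The supremum does not depend on \<open>b\<close>, so the inequality for a single
  \<open>b\<close> can be minimised over \<open>B\<close>. For empty \<open>B\<close> the right side
  is infinite.\<close>

lemma INF_triangle:
  assumes "ext_metric N d" "a \<in> N" "B \<subseteq> N" "C \<subseteq> N"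
  shows "(INF c\<in>C. d a c) \<le> (INF b\<in>B. d a b) + (SUP b\<in>B. INF c\<in>C. d b c)"
proof -
  have "(INF c\<in>C. d a c) \<le> (SUP b\<in>B. INF c\<in>C. d b c) + d a b" if b: "b \<in> B" for b
  proof -
    have "(INF c\<in>C. d a c) \<le> d a b + (INF c\<in>C. d b c)"
    proof (rule le_add_INF_ennreal)
      fix c assume c: "c \<in> C"
      then have "(INF c\<in>C. d a c) \<le> d a c" by (rule INF_lower)
      also have "\<dots> \<le> d a b + d b c"
        using assms b c by (intro ext_metric_triangle[OF assms(1)]) auto
      finally show "(INF c\<in>C. d a c) \<le> \<dots>" .
    qed
    also have "\<dots> \<le> d a b + (SUP b\<in>B. INF c\<in>C. d b c)"
      using b by (intro add_left_mono SUP_upper)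
    finally show ?thesis by (simp add: add.commute)
  qed
  then show ?thesis
    by (subst add.commute) (rule le_add_INF_ennreal)
qed

lemma SUP_INF_triangle:
  assumes "ext_metric N d" "A \<subseteq> N" "B \<subseteq> N" "C \<subseteq> N"
  shows "(SUP a\<in>A. INF c\<in>C. d a c) \<le> (SUP a\<in>A. INF b\<in>B. d a b) + (SUP b\<in>B. INF c\<in>C. d b c)"
proof (rule SUP_least)
  fix a assume a: "a \<in> A"
  have "(INF c\<in>C. d a c) \<le> (INF b\<in>B. d a b) + (SUP b\<in>B. INF c\<in>C. d b c)"
    using assms a by (intro INF_triangle) auto
  also have "\<dots> \<le> (SUP a\<in>A. INF b\<in>B. d a b) + (SUP b\<in>B. INF c\<in>C. d b c)"
    using a by (intro add_right_mono SUP_upper)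
  finally show "(INF c\<in>C. d a c) \<le> \<dots>" .
qed

lemma hausdorff_edist_commute: "hausdorff_edist d A B = hausdorff_edist d B A"
  by (simp add: hausdorff_edist_def max.commute)

lemma hausdorff_edist_triangle:
  assumes "ext_metric N d" "A \<subseteq> N" "B \<subseteq> N" "C \<subseteq> N"
  shows "hausdorff_edist d A C \<le> hausdorff_edist d A B + hausdorff_edist d B C"
  unfolding hausdorff_edist_def
proof (rule max.boundedI)
  show "(SUP a\<in>A. INF c\<in>C. d a c) \<le> max (SUP a\<in>A. INF b\<in>B. d a b) (SUP b\<in>B. INF a\<in>A. d b a) +
      max (SUP b\<in>B. INF c\<in>C. d b c) (SUP c\<in>C. INF b\<in>B. d c b)"
    by (rule order_trans[OF SUP_INF_triangle[OF assms]]) (intro add_mono max.cobounded1)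
  show "(SUP c\<in>C. INF a\<in>A. d c a) \<le> max (SUP a\<in>A. INF b\<in>B. d a b) (SUP b\<in>B. INF a\<in>A. d b a) +
      max (SUP b\<in>B. INF c\<in>C. d b c) (SUP c\<in>C. INF b\<in>B. d c b)"
    by (rule order_trans[OF SUP_INF_triangle[OF assms(1,4,3,2)]], subst add.commute)
       (intro add_mono max.cobounded2)
qed

lemma less_hausdorff_edistD:
  assumes "hausdorff_edist d A B < r"
  shows "a \<in> A \<Longrightarrow> (INF b\<in>B. d a b) < r" "b \<in> B \<Longrightarrow> (INF a\<in>A. d b a) < r"
  using assms unfolding hausdorff_edist_def
  by (auto intro: le_less_trans[OF SUP_upper])

section \<open>Metric axioms for the Hausdorff distance of compact sets\<close>

text \<open>Makes compact sets closed, so that zero Hausdorff distance forces equality. Balls of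
  half the distance are disjoint, also when that distance is infinite.\<close>

lemma Hausdorff_space_ext_mtopology:
  assumes "ext_metric N d"
  shows "Hausdorff_space (ext_mtopology N d)"
  unfolding Hausdorff_space_def
proof (intro allI impI)
  fix x y assume *: "x \<in> topspace (ext_mtopology N d) \<and> y \<in> topspace (ext_mtopology N d) \<and> x \<noteq> y"
  then have xy: "x \<in> N" "y \<in> N" "x \<noteq> y" by auto
  let ?r = "d x y / 2"
  have pos: "d x y > 0" using xy ext_metric_zero[OF assms] by (simp add: zero_less_iff_neq_zero)
  have "disjnt {z\<in>N. d x z < ?r} {z\<in>N. d y z < ?r}"
  proof -
    have False if "z \<in> N" "d x z < ?r" "d y z < ?r" for z
      using ext_metric_halves[OF assms xy(1) that(1) xy(2) that(2)] that
        ext_metric_commute[OF assms xy(2) that(1)] by simp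
    then show ?thesis by (auto simp: disjnt_def)
  qed
  moreover have "x \<in> {z\<in>N. d x z < ?r}" "y \<in> {z\<in>N. d y z < ?r}"
    using xy half_pos_ennreal[OF pos] ext_metric_zero[OF assms, of x x] ext_metric_zero[OF assms, of y y]
    by simp_all
  ultimately show "\<exists>U V. openin (ext_mtopology N d) U \<and> openin (ext_mtopology N d) V \<and> x \<in> U \<and> y \<in> V \<and> disjnt U V"
    using openin_ext_ball[OF assms xy(1)] openin_ext_ball[OF assms xy(2)] by blast
qed

lemma INF_eq_0_imp_mem:
  assumes "ext_metric N d" "closedin (ext_mtopology N d) B" "a \<in> N" "(INF b\<in>B. d a b) = 0"
  shows "a \<in> B"
proof (rule ccontr)
  assume "a \<notin> B"
  then have "openin (ext_mtopology N d) (N - B)" "a \<in> N - B"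
    using assms(2,3) by (auto simp: closedin_def)
  then obtain r where r: "r > 0" "{y\<in>N. d a y < r} \<subseteq> N - B"
    unfolding openin_ext_mtopology by blast
  have "B \<subseteq> N" using assms(2) closedin_subset by force
  then have "r \<le> (INF b\<in>B. d a b)"
    using r(2) by (intro INF_greatest) (force simp: not_less)
  with r(1) assms(4) show False by simp
qed

lemma hausdorff_edist_eq_0_imp_subset:
  assumes "ext_metric N d" "A \<subseteq> N" "compactin (ext_mtopology N d) B" "hausdorff_edist d A B = 0"
  shows "A \<subseteq> B"
proof
  fix a assume a: "a \<in> A"
  have "(INF b\<in>B. d a b) \<le> hausdorff_edist d A B"
    unfolding hausdorff_edist_def using a by (intro max.coboundedI1 SUP_upper)
  then show "a \<in> B"
    using INF_eq_0_imp_mem[OF assms(1) compactin_imp_closedin[OF Hausdorff_space_ext_mtopology[OF assms(1)] assms(3)]]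
      assms(2,4) a by auto
qed

lemma hausdorff_edist_self:
  assumes "ext_metric N d" "A \<subseteq> N"
  shows "hausdorff_edist d A A = 0"
proof -
  have "(INF b\<in>A. d a b) = 0" if "a \<in> A" for a
    using INF_lower[OF that, of "d a"] ext_metric_zero[OF assms(1), of a a] that assms(2) by auto
  then show ?thesis by (auto simp: hausdorff_edist_def SUP_constant bot_ennreal)
qed

text \<open>Compactness turns distance zero into equal sets, and injectivity turns equal sets into
  equal indices. The family \<open>f\<close> allows the points of the metric to be cosets rather
  than sets in \<open>M\<close>.\<close>

lemma ext_metric_hausdorff:
  assumes "ext_metric M d" "inj_on f N" "\<And>C. C \<in> N \<Longrightarrow> compactin (ext_mtopology M d) (f C)"
  shows "ext_metric N (\<lambda>A B. hausdorff_edist d (f A) (f B))"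
  unfolding ext_metric_def
proof (intro conjI ballI)
  have sub: "f C \<subseteq> M" if "C \<in> N" for C
    using compactin_subset_topspace[OF assms(3)[OF that]] by simp
  show "hausdorff_edist d (f A) (f B) = 0 \<longleftrightarrow> A = B" if "A \<in> N" "B \<in> N" for A B
  proof
    assume "hausdorff_edist d (f A) (f B) = 0"
    then have "f A = f B"
      using hausdorff_edist_eq_0_imp_subset[OF assms(1)] sub assms(3) that
      by (metis hausdorff_edist_commute subset_antisym)
    then show "A = B" using assms(2) that by (auto dest: inj_onD)
  qed (use hausdorff_edist_self[OF assms(1)] sub that in auto)
  show "hausdorff_edist d (f A) (f B) = hausdorff_edist d (f B) (f A)" for A B
    by (rule hausdorff_edist_commute)
  show "hausdorff_edist d (f A) (f C) \<le> hausdorff_edist d (f A) (f B) + hausdorff_edist d (f B) (f C)"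
    if "A \<in> N" "B \<in> N" "C \<in> N" for A B C
    using hausdorff_edist_triangle[OF assms(1)] sub that by simp
qed

text \<open>The radius is a Lebesgue number of a cover of \<open>A\<close> by balls on which domination holds.\<close>

lemma locally_dominated_near_compact:
  assumes "ext_metric M d" "locally_dominated M d \<rho>" "compactin (ext_mtopology M d) A"
  obtains r C where "r > 0" "C > 0"
    "\<And>a x y. \<lbrakk>a \<in> A; x \<in> M; y \<in> M; d a x < r; d a y < r\<rbrakk> \<Longrightarrow> \<rho> x y \<le> ennreal C * d x y"
proof -
  have AM: "A \<subseteq> M" using compactin_subset_topspace[OF assms(3)] by simp
  obtain R K where R: "\<And>p. p \<in> M \<Longrightarrow> R p > 0" and K: "\<And>p. p \<in> M \<Longrightarrow> K p > (0::real)"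
    and le: "\<And>p x y. \<lbrakk>p \<in> M; x \<in> M; y \<in> M; d p x < R p; d p y < R p\<rbrakk> \<Longrightarrow> \<rho> x y \<le> ennreal (K p) * d x y"
    using assms(2) unfolding locally_dominated_def by metis
  \<comment> \<open>Half radii leave room: a point within \<open>R p / 2\<close> of some
    \<open>a\<close> in \<open>?U p\<close> is still within \<open>R p\<close> of
    \<open>p\<close>.\<close>
  let ?U = "\<lambda>p. {x\<in>M. d p x < R p / 2}"
  have "\<exists>F. finite F \<and> F \<subseteq> ?U ` A \<and> A \<subseteq> \<Union>F"
  proof (rule compactinD[OF assms(3)])
    show "openin (ext_mtopology M d) U" if "U \<in> ?U ` A" for U
      using that AM openin_ext_ball[OF assms(1)] by auto
    show "A \<subseteq> \<Union>(?U ` A)"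
    proof
      fix a assume a: "a \<in> A"
      then have "a \<in> ?U a"
        using AM half_pos_ennreal[OF R[of a]] ext_metric_zero[OF assms(1), of a a] by auto
      with a show "a \<in> \<Union>(?U ` A)" by blast
    qed
  qed
  then obtain F where F: "finite F" "F \<subseteq> ?U ` A" "A \<subseteq> \<Union>F" by blast
  obtain P where "P \<subseteq> A" "finite P" "F = ?U ` P"
    using finite_subset_image[OF F(1,2)] by blast
  with F(3) have P: "finite P" "P \<subseteq> A" "A \<subseteq> \<Union>(?U ` P)" by simp_all
  \<comment> \<open>The inserted 1 keeps \<open>Min\<close> and \<open>Max\<close> meaningful for
    empty \<open>P\<close>, which occurs when \<open>A\<close> is empty.\<close>
  let ?r = "Min (insert 1 ((\<lambda>p. R p / 2) ` P))"
  let ?C = "Max (insert 1 (K ` P))"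
  show thesis
  proof (rule that)
    have "R p / 2 > 0" if "p \<in> P" for p
      using that P(2) AM by (intro half_pos_ennreal R) auto
    then show "?r > 0" using P(1) by (subst Min_gr_iff) auto
    have "1 \<le> ?C" using P by (intro Max_ge) auto
    then show "?C > 0" by linarith
    fix a x y assume *: "a \<in> A" "x \<in> M" "y \<in> M" "d a x < ?r" "d a y < ?r"
    obtain p where p: "p \<in> P" "d p a < R p / 2" using P * by blast
    have pM: "p \<in> M" using p P AM by auto
    have "?r \<le> R p / 2" using p P by (intro Min_le) auto
    then have "d p z < R p" if "z \<in> M" "d a z < ?r" for z
      using that AM *(1) by (intro ext_metric_halves[OF assms(1) pM _ that(1) p(2)]) auto
    then have "\<rho> x y \<le> ennreal (K p) * d x y"
      using * pM by (intro le) auto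
    also have "\<dots> \<le> ennreal ?C * d x y"
      using p P by (intro mult_right_mono ennreal_leI Max_ge) auto
    finally show "\<rho> x y \<le> ennreal ?C * d x y" .
  qed
qed

text \<open>Each \<open>x\<close> in \<open>B\<^sub>1\<close> has a point \<open>a\<close> of
  \<open>A\<close> within \<open>r / 2\<close>. Those \<open>y\<close> in \<open>B\<^sub>2\<close>
  within \<open>r / 2\<close> of \<open>x\<close> lie in the \<open>r\<close>-ball of
  \<open>a\<close>, where domination holds, and only such \<open>y\<close> matter for the
  infimum.\<close>

lemma SUP_INF_dominated:
  assumes "ext_metric M d" "C > 0" "A \<subseteq> M" "B\<^sub>1 \<subseteq> M" "B\<^sub>2 \<subseteq> M"
    and le: "\<And>a x y. \<lbrakk>a \<in> A; x \<in> M; y \<in> M; d a x < r; d a y < r\<rbrakk> \<Longrightarrow> \<rho> x y \<le> ennreal C * d x y"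
    and "hausdorff_edist d A B\<^sub>1 < r / 2" "hausdorff_edist d B\<^sub>1 B\<^sub>2 < r / 2"
  shows "(SUP x\<in>B\<^sub>1. INF y\<in>B\<^sub>2. \<rho> x y) \<le> ennreal C * hausdorff_edist d B\<^sub>1 B\<^sub>2"
proof (rule SUP_least)
  fix x assume x: "x \<in> B\<^sub>1"
  obtain a where a: "a \<in> A" "d x a < r / 2"
    using less_hausdorff_edistD(2)[OF assms(7) x] by (auto simp: INF_less_iff)
  then have ax: "d a x < r / 2"
    using ext_metric_commute[OF assms(1)] x assms(3,4) a(1) by (metis subsetD)
  have "(INF y\<in>B\<^sub>2. \<rho> x y) \<le> ennreal C * (INF y\<in>B\<^sub>2. d x y)"
  proof (rule INF_le_mult_INF)
    show "(INF y\<in>B\<^sub>2. d x y) < r / 2" using less_hausdorff_edistD(1)[OF assms(8) x] .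
    fix y assume y: "y \<in> B\<^sub>2" "d x y < r / 2"
    have "d a y < r"
      using a x y assms(3-5) by (intro ext_metric_halves[OF assms(1) _ _ _ ax y(2)]) auto
    then show "\<rho> x y \<le> ennreal C * d x y"
      using half_less_ennreal[OF ax] a x y assms(3-5) by (intro le[of a]) auto
  qed fact
  also have "\<dots> \<le> ennreal C * hausdorff_edist d B\<^sub>1 B\<^sub>2"
    unfolding hausdorff_edist_def using x by (intro mult_left_mono max.coboundedI1 SUP_upper) auto
  finally show "(INF y\<in>B\<^sub>2. \<rho> x y) \<le> \<dots>" .
qed

lemma locally_dominated_hausdorff:
  assumes "ext_metric M d" "locally_dominated M d \<rho>"
    "\<And>C. C \<in> N \<Longrightarrow> compactin (ext_mtopology M d) (f C)"
  shows "locally_dominated N (\<lambda>A B. hausdorff_edist d (f A) (f B)) (\<lambda>A B. hausdorff_edist \<rho> (f A) (f B))"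
  unfolding locally_dominated_def
proof
  fix P assume P: "P \<in> N"
  have sub: "f C \<subseteq> M" if "C \<in> N" for C
    using compactin_subset_topspace[OF assms(3)[OF that]] by simp
  obtain r C where r: "r > 0" "C > 0"
    and le: "\<And>a x y. \<lbrakk>a \<in> f P; x \<in> M; y \<in> M; d a x < r; d a y < r\<rbrakk> \<Longrightarrow> \<rho> x y \<le> ennreal C * d x y"
    using locally_dominated_near_compact[OF assms(1,2) assms(3)[OF P]] by blast
  \<comment> \<open>Quarter radii put \<open>f A\<close> and \<open>f B\<close> within
    \<open>r / 2\<close> of \<open>f P\<close> and of each other; the two halves of the maximum come
    from exchanging \<open>A\<close> and \<open>B\<close>.\<close>
  have "hausdorff_edist \<rho> (f A) (f B) \<le> ennreal C * hausdorff_edist d (f A) (f B)"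
    if AB: "A \<in> N" "B \<in> N" "hausdorff_edist d (f P) (f A) < r / 2 / 2" "hausdorff_edist d (f P) (f B) < r / 2 / 2"
    for A B
  proof -
    have AB': "hausdorff_edist d (f A) (f B) < r / 2"
      using add_less_half_ennreal[OF AB(3,4)] hausdorff_edist_triangle[OF assms(1), of "f A" "f P" "f B"]
        sub P AB hausdorff_edist_commute[of d "f A" "f P"] by auto
    have "(SUP x\<in>f A. INF y\<in>f B. \<rho> x y) \<le> ennreal C * hausdorff_edist d (f A) (f B)"
      by (rule SUP_INF_dominated[OF assms(1) r(2) sub[OF P] sub[OF AB(1)] sub[OF AB(2)] le
            half_less_ennreal[OF AB(3)] AB'])
    moreover have "(SUP x\<in>f B. INF y\<in>f A. \<rho> x y) \<le> ennreal C * hausdorff_edist d (f B) (f A)"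
      by (rule SUP_INF_dominated[OF assms(1) r(2) sub[OF P] sub[OF AB(2)] sub[OF AB(1)] le
            half_less_ennreal[OF AB(4)] AB'[unfolded hausdorff_edist_commute[of d "f A"]]])
    ultimately show ?thesis
      unfolding hausdorff_edist_def[of \<rho>] hausdorff_edist_commute[of d "f B" "f A"] by simp
  qed
  then show "\<exists>r>0. \<exists>C>0. \<forall>x\<in>N. \<forall>y\<in>N. hausdorff_edist d (f P) (f x) < r \<longrightarrow> hausdorff_edist d (f P) (f y) < r \<longrightarrow>
      hausdorff_edist \<rho> (f x) (f y) \<le> ennreal C * hausdorff_edist d (f x) (f y)"
    using r half_pos_ennreal by blast
qed

section \<open>Intrinsic metrics\<close>

lemma ext_path_length_ge:
  fixes t :: "nat \<Rightarrow> real"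
  assumes "t 0 = 0" "t n = 1" "\<And>i. i \<in> {1..n} \<Longrightarrow> t (i - 1) \<le> t i"
  shows "(\<Sum>i=1..n. \<sigma> (\<gamma> (t i)) (\<gamma> (t (i - 1)))) \<le> ext_path_length \<sigma> \<gamma>"
  unfolding ext_path_length_def using assms by (intro Sup_upper) blast

text \<open>Monotonicity between the endpoints 0 and 1 confines \<open>t\<close> to the unit
  interval; having this as a premise lets the path be evaluated only where it is known to lie in the
  carrier.\<close>

lemma ext_path_length_least:
  assumes "\<And>(n::nat) t. \<lbrakk>t 0 = 0; t n = 1; \<And>i. i \<in> {1..n} \<Longrightarrow> t (i - 1) \<le> t i; \<And>i. i \<le> n \<Longrightarrow> t i \<in> {0..1}\<rbrakk>
    \<Longrightarrow> (\<Sum>i=1..n. \<sigma> (\<gamma> (t i)) (\<gamma> (t (i - 1)))) \<le> L"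
  shows "ext_path_length \<sigma> \<gamma> \<le> L"
  unfolding ext_path_length_def
proof (rule Sup_least, clarify)
  fix n :: nat and t :: "nat \<Rightarrow> real"
  assume t: "t 0 = 0" "t n = 1" and mono: "\<forall>i\<in>{1..n}. t (i - 1) \<le> t i"
  have "t i \<in> {0..1}" if "i \<le> n" for i
  proof -
    have "t i \<le> t j" if "i \<le> j" "j \<le> n" for i j
      using that
    proof (induction j rule: dec_induct)
      case (step k)
      then show ?case using mono[rule_format, of "Suc k"] by force
    qed simp
    from this[of 0 i] this[of i n] show ?thesis using that t by auto
  qed
  then show "(\<Sum>i=1..n. \<sigma> (\<gamma> (t i)) (\<gamma> (t (i - 1)))) \<le> L"
    using t mono by (intro assms) blast+
qed

lemma ext_path_length_const:
  assumes "ext_metric N d" "x \<in> N"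
  shows "ext_path_length d (\<lambda>_. x) = 0"
proof -
  have "ext_path_length d (\<lambda>_. x) \<le> 0"
    using ext_metric_zero[OF assms(1)] assms(2) by (intro ext_path_length_least) simp
  then show ?thesis by simp
qed

lemma ext_path_length_dominated:
  assumes "\<And>s s'. \<lbrakk>s \<in> {0..1}; s' \<in> {0..1}\<rbrakk> \<Longrightarrow> \<rho> (\<gamma> s) (\<gamma> s') \<le> C * d (\<gamma> s) (\<gamma> s')"
  shows "ext_path_length \<rho> \<gamma> \<le> C * ext_path_length d \<gamma>"
proof (rule ext_path_length_least)
  fix n and t :: "nat \<Rightarrow> real"
  assume t: "t 0 = 0" "t n = 1" "\<And>i. i \<in> {1..n} \<Longrightarrow> t (i - 1) \<le> t i" "\<And>i. i \<le> n \<Longrightarrow> t i \<in> {0..1}"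
  have "(\<Sum>i=1..n. \<rho> (\<gamma> (t i)) (\<gamma> (t (i - 1)))) \<le> (\<Sum>i=1..n. C * d (\<gamma> (t i)) (\<gamma> (t (i - 1))))"
    using t(4) by (intro sum_mono assms) auto
  also have "\<dots> = C * (\<Sum>i=1..n. d (\<gamma> (t i)) (\<gamma> (t (i - 1))))"
    by (simp add: sum_distrib_left)
  also have "\<dots> \<le> C * ext_path_length d \<gamma>"
    using t by (intro mult_left_mono ext_path_length_ge) auto
  finally show "(\<Sum>i=1..n. \<rho> (\<gamma> (t i)) (\<gamma> (t (i - 1)))) \<le> \<dots>" .
qed

lemma pathin_mem:
  assumes "pathin (ext_mtopology N d) \<gamma>" "s \<in> {0..1}"
  shows "\<gamma> s \<in> N"
  using path_image_subset_topspace[OF assms(1)] assms(2) by auto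

text \<open>At \<open>s = 1\<close> this compares \<open>d\<close> with its intrinsic metric; for
  general \<open>s\<close> it confines a short path to a ball around its start.\<close>

lemma edist_le_ext_path_length:
  assumes "ext_metric N d" "pathin (ext_mtopology N d) \<gamma>" "s \<in> {0..1}"
  shows "d (\<gamma> 0) (\<gamma> s) \<le> ext_path_length d \<gamma>"
proof -
  \<comment> \<open>The partition \<open>0, s, 1\<close>, whose second summand is then dropped;
    \<open>s\<close> may coincide with an endpoint.\<close>
  let ?t = "\<lambda>i::nat. if i = 0 then 0 else if i = 1 then s else 1"
  have "(\<Sum>i=1..2. d (\<gamma> (?t i)) (\<gamma> (?t (i - 1)))) \<le> ext_path_length d \<gamma>"
    using assms(3) by (intro ext_path_length_ge) auto
  also have "(\<Sum>i=1..2. d (\<gamma> (?t i)) (\<gamma> (?t (i - 1)))) = d (\<gamma> s) (\<gamma> 0) + d (\<gamma> 1) (\<gamma> s)"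
    by (simp add: numeral_2_eq_2)
  finally have "d (\<gamma> s) (\<gamma> 0) \<le> ext_path_length d \<gamma>"
    by (rule order_trans[rotated]) simp
  moreover have "d (\<gamma> s) (\<gamma> 0) = d (\<gamma> 0) (\<gamma> s)"
    using pathin_mem[OF assms(2)] assms(3) by (intro ext_metric_commute[OF assms(1)]) auto
  ultimately show ?thesis by simp
qed

section \<open>Reversal and concatenation of paths\<close>

lemma pathin_reverse:
  assumes "pathin X \<gamma>"
  shows "pathin X (\<lambda>s. \<gamma> (1 - s))"
proof -
  have "continuous_map (top_of_set {0..1}) (top_of_set {0..1}) (\<lambda>s::real. 1 - s)"
    by (auto simp: continuous_map_in_subtopology intro!: continuous_intros)
  from continuous_map_compose[OF this assms[unfolded pathin_def]] show ?thesis
    by (simp add: pathin_def o_def)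
qed

lemma ext_path_length_reverse:
  assumes "ext_metric N d" "pathin (ext_mtopology N d) \<gamma>"
  shows "ext_path_length d (\<lambda>s. \<gamma> (1 - s)) \<le> ext_path_length d \<gamma>"
proof (rule ext_path_length_least)
  fix n and t :: "nat \<Rightarrow> real"
  assume t: "t 0 = 0" "t n = 1" "\<And>i. i \<in> {1..n} \<Longrightarrow> t (i - 1) \<le> t i" "\<And>i. i \<le> n \<Longrightarrow> t i \<in> {0..1}"
  \<comment> \<open>The partition \<open>t\<close> traversed backwards. Summand \<open>i\<close>
    joins the points \<open>i - 1\<close> and \<open>i\<close>, so it matches summand
    \<open>n + 1 - i\<close> of \<open>u\<close> with its arguments swapped; symmetry of
    \<open>d\<close> restores their order.\<close>
  define u where "u i = 1 - t (n - i)" for i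
  have "(\<Sum>i=1..n. d (\<gamma> (1 - t i)) (\<gamma> (1 - t (i - 1)))) =
      (\<Sum>i=1..n. d (\<gamma> (u i)) (\<gamma> (u (i - 1))))"
  proof (rule sum.reindex_bij_witness[of _ "\<lambda>i. n + 1 - i" "\<lambda>i. n + 1 - i"])
    fix i assume i: "i \<in> {1..n}"
    then have u: "u (n + 1 - i) = 1 - t (i - 1)" "u (n + 1 - i - 1) = 1 - t i"
      by (auto simp: u_def)
    have "1 - t i \<in> {0..1}" "1 - t (i - 1) \<in> {0..1}"
      using i t(4)[of i] t(4)[of "i - 1"] by auto
    then show "d (\<gamma> (u (n + 1 - i))) (\<gamma> (u (n + 1 - i - 1))) = d (\<gamma> (1 - t i)) (\<gamma> (1 - t (i - 1)))"
      unfolding u by (intro ext_metric_commute[OF assms(1)] pathin_mem[OF assms(2)])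
  qed auto
  also have "\<dots> \<le> ext_path_length d \<gamma>"
  proof (rule ext_path_length_ge)
    show "u (i - 1) \<le> u i" if "i \<in> {1..n}" for i
    proof -
      have "n - (i - 1) = n - i + 1" "n - i + 1 \<in> {1..n}" using that by auto
      then show ?thesis using t(3)[of "n - i + 1"] by (simp add: u_def)
    qed
  qed (use t in \<open>auto simp: u_def\<close>)
  finally show "(\<Sum>i=1..n. d (\<gamma> (1 - t i)) (\<gamma> (1 - t (i - 1)))) \<le> ext_path_length d \<gamma>" .
qed

definition joined_path :: "(real \<Rightarrow> 'a) \<Rightarrow> (real \<Rightarrow> 'a) \<Rightarrow> real \<Rightarrow> 'a" where
  "joined_path \<gamma> \<delta> s = (if s \<le> 1/2 then \<gamma> (2 * s) else \<delta> (2 * s - 1))"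

lemma pathin_joined_path:
  assumes "pathin X \<gamma>" "pathin X \<delta>" "\<gamma> 1 = \<delta> 0"
  shows "pathin X (joined_path \<gamma> \<delta>)"
  unfolding pathin_def joined_path_def
proof (rule continuous_map_cases_le)
  show "continuous_map (top_of_set {0..1}) euclideanreal (\<lambda>s. s)"
    "continuous_map (top_of_set {0..1}) euclideanreal (\<lambda>s. 1/2)"
    by (auto intro: continuous_intros)
  have "continuous_map (top_of_set {0..1/2}) (top_of_set {0..1}) (\<lambda>s::real. 2 * s)"
    by (auto simp: continuous_map_in_subtopology intro!: continuous_intros)
  from continuous_map_compose[OF this assms(1)[unfolded pathin_def]]
  have 1: "continuous_map (top_of_set {0..1/2}) X (\<lambda>s. \<gamma> (2 * s))" by (simp add: o_def)
  have "continuous_map (top_of_set {1/2..1}) (top_of_set {0..1}) (\<lambda>s::real. 2 * s - 1)"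
    by (auto simp: continuous_map_in_subtopology intro!: continuous_intros)
  from continuous_map_compose[OF this assms(2)[unfolded pathin_def]]
  have 2: "continuous_map (top_of_set {1/2..1}) X (\<lambda>s. \<delta> (2 * s - 1))" by (simp add: o_def)
  have "{s. 0 \<le> s \<and> s \<le> 1 \<and> s \<le> 1/2} = {0..1/2::real}" "{s. 0 \<le> s \<and> s \<le> 1 \<and> 1/2 \<le> s} = {1/2..1::real}"
    "{0..1} \<inter> {0..1/2::real} = {0..1/2}" "{0..1} \<inter> {1/2..1::real} = {1/2..1}" by auto
  with 1 2 show "continuous_map (subtopology (top_of_set {0..1}) {s \<in> topspace (top_of_set {0..1}). s \<le> 1/2}) X (\<lambda>s. \<gamma> (2 * s))"
    "continuous_map (subtopology (top_of_set {0..1}) {s \<in> topspace (top_of_set {0..1}). 1/2 \<le> s}) X (\<lambda>s. \<delta> (2 * s - 1))"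
    by (simp_all add: subtopology_subtopology conj_assoc)
  show "\<gamma> (2 * s) = \<delta> (2 * s - 1)" if "s = 1/2" for s
    unfolding that using assms(3) by simp
qed

text \<open>A partition \<open>t\<close> of the joined path is pulled back to both halves by clamping, which keeps the
  number of points and so compares the sums term by term.\<close>

lemma ext_path_length_joined_path:
  assumes "ext_metric N d" "pathin (ext_mtopology N d) \<gamma>" "pathin (ext_mtopology N d) \<delta>" "\<gamma> 1 = \<delta> 0"
  shows "ext_path_length d (joined_path \<gamma> \<delta>) \<le> ext_path_length d \<gamma> + ext_path_length d \<delta>"
proof (rule ext_path_length_least)
  fix n and t :: "nat \<Rightarrow> real"
  assume t: "t 0 = 0" "t n = 1" "\<And>i. i \<in> {1..n} \<Longrightarrow> t (i - 1) \<le> t i" "\<And>i. i \<le> n \<Longrightarrow> t i \<in> {0..1}"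
  let ?\<eta> = "joined_path \<gamma> \<delta>"
  define u where "u i = min 1 (2 * t i)" for i
  define v where "v i = max 0 (2 * t i - 1)" for i
  have le: "d (?\<eta> (t i)) (?\<eta> (t (i - 1))) \<le>
      d (\<gamma> (u i)) (\<gamma> (u (i - 1))) + d (\<delta> (v i)) (\<delta> (v (i - 1)))" if i: "i \<in> {1..n}" for i
  proof -
    have ti: "0 \<le> t (i - 1)" "t (i - 1) \<le> t i" "t i \<le> 1" using t(3)[of i] t(4)[of i] t(4)[of "i - 1"] i by auto
    consider "t i \<le> 1/2" | "t (i - 1) > 1/2" | "t (i - 1) \<le> 1/2" "t i > 1/2" by linarith
    then show ?thesis
    proof cases
      case 1
      with ti show ?thesis by (simp add: joined_path_def u_def)
    next
      case 2
      with ti show ?thesis by (simp add: joined_path_def v_def)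
    next
      \<comment> \<open>The partition interval straddles the junction, so the point
        \<open>\<gamma> 1 = \<delta> 0\<close> is inserted by the triangle inequality.\<close>
      case 3
      then have eq: "?\<eta> (t i) = \<delta> (v i)" "?\<eta> (t (i - 1)) = \<gamma> (u (i - 1))" "u i = 1" "v (i - 1) = 0"
        by (auto simp: joined_path_def u_def v_def)
      have "v i \<in> {0..1}" "u (i - 1) \<in> {0..1}" using ti by (auto simp: u_def v_def)
      then have "d (\<delta> (v i)) (\<gamma> (u (i - 1))) \<le> d (\<delta> (v i)) (\<delta> 0) + d (\<delta> 0) (\<gamma> (u (i - 1)))"
        using pathin_mem[OF assms(2)] pathin_mem[OF assms(3)]
        by (intro ext_metric_triangle[OF assms(1)]) auto
      then show ?thesis unfolding eq assms(4) by (simp add: add.commute)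
    qed
  qed
  have "(\<Sum>i=1..n. d (?\<eta> (t i)) (?\<eta> (t (i - 1)))) \<le>
      (\<Sum>i=1..n. d (\<gamma> (u i)) (\<gamma> (u (i - 1))) + d (\<delta> (v i)) (\<delta> (v (i - 1))))"
    by (rule sum_mono) (rule le)
  also have "\<dots> = (\<Sum>i=1..n. d (\<gamma> (u i)) (\<gamma> (u (i - 1)))) + (\<Sum>i=1..n. d (\<delta> (v i)) (\<delta> (v (i - 1))))"
    by (rule sum.distrib)
  also have "\<dots> \<le> ext_path_length d \<gamma> + ext_path_length d \<delta>"
  proof (intro add_mono ext_path_length_ge)
    show "u (i - 1) \<le> u i" "v (i - 1) \<le> v i" if "i \<in> {1..n}" for i
      using t(3)[OF that] by (auto simp: u_def v_def)
  qed (use t in \<open>auto simp: u_def v_def\<close>)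
  finally show "(\<Sum>i=1..n. d (?\<eta> (t i)) (?\<eta> (t (i - 1)))) \<le> \<dots>" .
qed

section \<open>The intrinsic metric and its domination\<close>

abbreviation paths_between :: "'a topology \<Rightarrow> 'a \<Rightarrow> 'a \<Rightarrow> (real \<Rightarrow> 'a) set" where
  "paths_between X x y \<equiv> {\<gamma>. pathin X \<gamma> \<and> \<gamma> 0 = x \<and> \<gamma> 1 = y}"

lemma intrinsic_edist_eq_INF:
  "intrinsic_edist N d x y = (INF \<gamma>\<in>paths_between (ext_mtopology N d) x y. ext_path_length d \<gamma>)"
  unfolding intrinsic_edist_def by (rule arg_cong[where f = Inf]) auto

lemma edist_le_intrinsic_edist:
  assumes "ext_metric N d"
  shows "d x y \<le> intrinsic_edist N d x y"
  unfolding intrinsic_edist_eq_INF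
  using edist_le_ext_path_length[OF assms, of _ 1] by (intro INF_greatest) auto

text \<open>Constant paths give distance zero, reversal gives symmetry and concatenation the
  triangle inequality; points are separated because the intrinsic metric is at least
  \<open>d\<close>.\<close>

lemma ext_metric_intrinsic:
  assumes "ext_metric N d"
  shows "ext_metric N (intrinsic_edist N d)"
  unfolding ext_metric_def
proof (intro conjI ballI)
  fix x y assume xy: "x \<in> N" "y \<in> N"
  have le: "intrinsic_edist N d x y \<le> intrinsic_edist N d y x" for x y
    unfolding intrinsic_edist_eq_INF
  proof (rule INF_mono)
    fix \<gamma> assume \<gamma>: "\<gamma> \<in> paths_between (ext_mtopology N d) y x"
    then show "\<exists>\<delta>\<in>paths_between (ext_mtopology N d) x y. ext_path_length d \<delta> \<le> ext_path_length d \<gamma>"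
      using pathin_reverse ext_path_length_reverse[OF assms]
      by (intro bexI[of _ "\<lambda>s. \<gamma> (1 - s)"]) auto
  qed
  show "intrinsic_edist N d x y = intrinsic_edist N d y x"
    using le by (intro antisym)
  show "intrinsic_edist N d x y = 0 \<longleftrightarrow> x = y"
  proof
    assume "intrinsic_edist N d x y = 0"
    then show "x = y"
      using edist_le_intrinsic_edist[OF assms, of x y] ext_metric_zero[OF assms xy] by simp
  next
    assume "x = y"
    have "intrinsic_edist N d x x \<le> ext_path_length d (\<lambda>_. x)"
      unfolding intrinsic_edist_eq_INF using xy by (intro INF_lower) simp
    with \<open>x = y\<close> show "intrinsic_edist N d x y = 0"
      using ext_path_length_const[OF assms xy(1)] by simp
  qed
  fix z assume z: "z \<in> N"
  let ?P = "paths_between (ext_mtopology N d)"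
  have "intrinsic_edist N d x z \<le> ext_path_length d \<gamma> + ext_path_length d \<delta>"
    if "\<gamma> \<in> ?P x y" "\<delta> \<in> ?P y z" for \<gamma> \<delta>
  proof -
    have "joined_path \<gamma> \<delta> \<in> ?P x z"
      using that pathin_joined_path[of _ \<gamma> \<delta>] by (auto simp: joined_path_def)
    then have "intrinsic_edist N d x z \<le> ext_path_length d (joined_path \<gamma> \<delta>)"
      unfolding intrinsic_edist_eq_INF by (rule INF_lower)
    also have "\<dots> \<le> ext_path_length d \<gamma> + ext_path_length d \<delta>"
      using that by (intro ext_path_length_joined_path[OF assms]) auto
    finally show ?thesis .
  qed
  \<comment> \<open>The infimum is taken over \<open>\<delta>\<close> with \<open>\<gamma>\<close>
    fixed, and afterwards over \<open>\<gamma>\<close>.\<close>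
  then have "intrinsic_edist N d x z \<le> intrinsic_edist N d y z + ext_path_length d \<gamma>"
    if "\<gamma> \<in> ?P x y" for \<gamma>
    unfolding intrinsic_edist_eq_INF[of N d y z]
    using that by (subst add.commute) (intro le_add_INF_ennreal)
  then show "intrinsic_edist N d x z \<le> intrinsic_edist N d x y + intrinsic_edist N d y z"
    unfolding intrinsic_edist_eq_INF[of N d x y] by (subst add.commute) (intro le_add_INF_ennreal)
qed

lemma locally_dominated_intrinsic:
  assumes "ext_metric N d" "locally_dominated N d \<rho>" and eq: "ext_mtopology N d = ext_mtopology N \<rho>"
  shows "locally_dominated N (intrinsic_edist N d) (intrinsic_edist N \<rho>)"
  unfolding locally_dominated_def
proof
  fix p assume p: "p \<in> N"
  obtain r C where r: "r > 0" "C > 0"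
    and le: "\<And>x y. \<lbrakk>x \<in> N; y \<in> N; d p x < r; d p y < r\<rbrakk> \<Longrightarrow> \<rho> x y \<le> ennreal C * d x y"
    using assms(2) p unfolding locally_dominated_def by meson
  note m = ext_metric_intrinsic[OF assms(1)]
  have "intrinsic_edist N \<rho> x y \<le> ennreal C * intrinsic_edist N d x y"
    if xy: "x \<in> N" "y \<in> N" "intrinsic_edist N d p x < r / 2 / 2" "intrinsic_edist N d p y < r / 2 / 2" for x y
    \<comment> \<open>Rewriting with \<open>eq\<close> makes both infima range over the same set of
      paths.\<close>
    unfolding intrinsic_edist_eq_INF eq[symmetric]
  proof (rule INF_le_mult_INF)
    have "intrinsic_edist N d x y < r / 2"
      using xy ext_metric_commute[OF m xy(1) p]
      by (intro ext_metric_halves[OF m xy(1) p xy(2)]) auto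
    then show "(INF \<gamma>\<in>paths_between (ext_mtopology N d) x y. ext_path_length d \<gamma>) < r / 2"
      by (simp add: intrinsic_edist_eq_INF)
    fix \<gamma> assume \<gamma>: "\<gamma> \<in> paths_between (ext_mtopology N d) x y" "ext_path_length d \<gamma> < r / 2"
    \<comment> \<open>Since \<open>d\<close> is at most its intrinsic metric, \<open>x\<close> is
      within \<open>r / 2\<close> of \<open>p\<close> for \<open>d\<close>; a path from
      \<open>x\<close> of length below \<open>r / 2\<close> thus stays in the \<open>r\<close>-ball
      of \<open>p\<close>.\<close>
    have px: "d p x < r / 2"
      using edist_le_intrinsic_edist[OF assms(1)] half_less_ennreal[OF xy(3)] by (rule le_less_trans)
    have "d p (\<gamma> s) < r" if s: "s \<in> {0..1}" for s
    proof -
      have "d x (\<gamma> s) < r / 2"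
        using edist_le_ext_path_length[OF assms(1), of \<gamma> s] \<gamma> s by auto
      then show ?thesis
        using pathin_mem[of N d \<gamma> s] \<gamma>(1) s by (intro ext_metric_halves[OF assms(1) p xy(1) _ px]) auto
    qed
    then show "ext_path_length \<rho> \<gamma> \<le> ennreal C * ext_path_length d \<gamma>"
      using \<gamma> pathin_mem by (intro ext_path_length_dominated le) blast+
  qed fact
  then show "\<exists>r>0. \<exists>C>0. \<forall>x\<in>N. \<forall>y\<in>N. intrinsic_edist N d p x < r \<longrightarrow> intrinsic_edist N d p y < r \<longrightarrow>
      intrinsic_edist N \<rho> x y \<le> ennreal C * intrinsic_edist N d x y"
    using r half_pos_ennreal by blast
qed

lemma locally_Lipschitz_equivalent_intrinsic:
  assumes "locally_Lipschitz_equivalent N d \<rho>"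
  shows "locally_Lipschitz_equivalent N (intrinsic_edist N d) (intrinsic_edist N \<rho>)"
proof -
  have "ext_mtopology N d = ext_mtopology N \<rho>"
    using assms by (simp add: locally_Lipschitz_equivalent_def)
  with assms show ?thesis
    by (auto simp: locally_Lipschitz_equivalent_iff intro!: ext_metric_intrinsic locally_dominated_intrinsic)
qed

section \<open>Translates of a set under a group action\<close>

text \<open>If \<open>k\<close> and \<open>g\<close> move \<open>X\<close> to the same set, then the
  product of the inverse of \<open>g\<close> with \<open>k\<close> fixes \<open>X\<close>. So cosets
  are the fibres of the map sending \<open>g\<close> to its translate of \<open>X\<close>, and a
  translate determines its coset.\<close>

lemma l_coset_isotropy:
  assumes "group_action G M \<phi>" "X \<subseteq> M" "g \<in> carrier G"
  shows "g <#\<^bsub>G\<^esub> isotropy G \<phi> X = {k \<in> carrier G. \<phi> k ` X = \<phi> g ` X}"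
proof -
  interpret group_action G M \<phi> by fact
  interpret group G using group_hom by (simp add: group_hom_def)
  have comp: "\<phi> (k \<otimes>\<^bsub>G\<^esub> h) ` X = \<phi> k ` (\<phi> h ` X)" if "k \<in> carrier G" "h \<in> carrier G" for h k
    using assms(2) that composition_rule unfolding image_image by (intro image_cong) auto
  have one: "\<phi> \<one>\<^bsub>G\<^esub> ` X = X"
    using assms(2) by (force simp flip: id_eq_one)
  show ?thesis
  proof (intro Set.set_eqI iffI)
    fix k assume "k \<in> g <#\<^bsub>G\<^esub> isotropy G \<phi> X"
    then obtain h where h: "h \<in> carrier G" "\<phi> h ` X = X" "k = g \<otimes>\<^bsub>G\<^esub> h"
      by (auto simp: l_coset_def isotropy_def stabilizer_def)
    with comp[OF assms(3) h(1)] assms(3) show "k \<in> {k \<in> carrier G. \<phi> k ` X = \<phi> g ` X}"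
      by simp
  next
    fix k assume k: "k \<in> {k \<in> carrier G. \<phi> k ` X = \<phi> g ` X}"
    let ?h = "inv\<^bsub>G\<^esub> g \<otimes>\<^bsub>G\<^esub> k"
    have k': "k \<in> carrier G" "\<phi> k ` X = \<phi> g ` X" using k by auto
    have inv: "inv\<^bsub>G\<^esub> g \<in> carrier G" using assms(3) by simp
    have "\<phi> ?h ` X = \<phi> (inv\<^bsub>G\<^esub> g \<otimes>\<^bsub>G\<^esub> g) ` X"
      unfolding comp[OF inv k'(1)] comp[OF inv assms(3)] k'(2) ..
    then have "\<phi> ?h ` X = X"
      unfolding l_inv[OF assms(3)] one .
    then have "?h \<in> isotropy G \<phi> X"
      using k' inv by (simp add: isotropy_def stabilizer_def)
    moreover have "k = g \<otimes>\<^bsub>G\<^esub> ?h"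
      using k'(1) assms(3) by (simp flip: m_assoc)
    ultimately show "k \<in> g <#\<^bsub>G\<^esub> isotropy G \<phi> X"
      unfolding l_coset_def by blast
  qed
qed

lemma inj_on_coset_translate:
  assumes "group_action G M \<phi>" "X \<subseteq> M"
  shows "inj_on (coset_translate \<phi> X) (lcosets\<^bsub>G\<^esub> (isotropy G \<phi> X))"
  using coset_translate_l_coset[OF assms] l_coset_isotropy[OF assms]
  by (auto simp: inj_on_def LCOSETS_def)

text \<open>Restricting the action to the slice of a fixed \<open>g\<close> shows that
  \<open>\<phi> g\<close> is continuous, so it maps \<open>X\<close> to a compact set.\<close>

lemma compactin_coset_translate:
  assumes "group_action G M \<phi>" "topspace T = carrier G" "topspace S = M"
    and "continuous_map (prod_topology T S) S (\<lambda>(g, x). \<phi> g x)"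
    and "compactin S X" "C \<in> lcosets\<^bsub>G\<^esub> (isotropy G \<phi> X)"
  shows "compactin S (coset_translate \<phi> X C)"
proof -
  obtain g where g: "g \<in> carrier G" "C = g <#\<^bsub>G\<^esub> isotropy G \<phi> X"
    using assms(6) by (auto simp: LCOSETS_def)
  have "continuous_map S (prod_topology T S) (\<lambda>x. (g, x))"
    using g(1) assms(2) by (auto simp: continuous_map_pairwise o_def)
  from continuous_map_compose[OF this assms(4)] have "continuous_map S S (\<phi> g)"
    by (simp add: o_def)
  then have "compactin S (\<phi> g ` X)" by (rule image_compactin[OF assms(5)])
  moreover have "X \<subseteq> M" using compactin_subset_topspace[OF assms(5)] assms(3) by simp
  ultimately show ?thesis
    using coset_translate_l_coset[OF assms(1) _ g(1)] g(2) by simp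
qed

theorem theorem4p10:
  fixes M X :: "'a set"
    and d \<rho> :: "'a \<Rightarrow> 'a \<Rightarrow> ennreal"
    and G :: "('g, 'm) monoid_scheme"
    and T :: "'g topology"
    and \<phi> :: "'g \<Rightarrow> 'a \<Rightarrow> 'a"
  assumes "locally_Lipschitz_equivalent M d \<rho>"
    and "locally_compact_space (ext_mtopology M d)"
    and "topological_group G T"
    and "group_action G M \<phi>"
    and "continuous_map (prod_topology T (ext_mtopology M d)) (ext_mtopology M d)
           (\<lambda>(g, x). \<phi> g x)"
    and "compactin (ext_mtopology M d) X"
    and "X \<noteq> {}"
  shows "locally_Lipschitz_equivalent (lcosets\<^bsub>G\<^esub> (isotropy G \<phi> X))
             (coset_hausdorff \<phi> X d) (coset_hausdorff \<phi> X \<rho>) \<and>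
         locally_Lipschitz_equivalent (lcosets\<^bsub>G\<^esub> (isotropy G \<phi> X))
             (intrinsic_edist (lcosets\<^bsub>G\<^esub> (isotropy G \<phi> X)) (coset_hausdorff \<phi> X d))
             (intrinsic_edist (lcosets\<^bsub>G\<^esub> (isotropy G \<phi> X)) (coset_hausdorff \<phi> X \<rho>))"
proof -
  let ?N = "lcosets\<^bsub>G\<^esub> (isotropy G \<phi> X)" and ?f = "coset_translate \<phi> X"
  have eq: "ext_mtopology M d = ext_mtopology M \<rho>"
    using assms(1) by (simp add: locally_Lipschitz_equivalent_def)
  have cpt: "compactin (ext_mtopology M d) (?f C)" if "C \<in> ?N" for C
    using assms(3) that
    by (intro compactin_coset_translate[OF assms(4) _ _ assms(5,6)]) (auto simp: topological_group_def)
  have inj: "inj_on ?f ?N"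
    using compactin_subset_topspace[OF assms(6)] by (intro inj_on_coset_translate[OF assms(4)]) simp
  have L: "ext_metric M d" "ext_metric M \<rho>" "locally_dominated M d \<rho>" "locally_dominated M \<rho> d"
    using assms(1) by (simp_all add: locally_Lipschitz_equivalent_iff)
  have H: "coset_hausdorff \<phi> X \<sigma> = (\<lambda>A B. hausdorff_edist \<sigma> (?f A) (?f B))" for \<sigma>
    by (simp add: coset_hausdorff_def fun_eq_iff)
  \<comment> \<open>The results on families of compact sets apply with \<open>?f\<close> as the
    family; \<open>cpt[unfolded eq]\<close> supplies compactness for \<open>\<rho>\<close>, whose
    topology is that of \<open>d\<close>.\<close>
  have "locally_Lipschitz_equivalent ?N (coset_hausdorff \<phi> X d) (coset_hausdorff \<phi> X \<rho>)"
    unfolding locally_Lipschitz_equivalent_iff H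
    by (intro conjI ext_metric_hausdorff[OF L(1) inj cpt] ext_metric_hausdorff[OF L(2) inj cpt[unfolded eq]]
        locally_dominated_hausdorff[OF L(1,3) cpt] locally_dominated_hausdorff[OF L(2,4) cpt[unfolded eq]])
  then show ?thesis
    using locally_Lipschitz_equivalent_intrinsic by blast
qed

end
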